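(* For every transport choice situation $\theta=(N,p,c,\alpha,\beta)\in\Theta$ with associated transport choice game $(N,v^{\theta})$, the market share exchange allocation $MSE=(MSE_i)_{i\in N}$ belongs to the core of the game: $MSE\in\mathscr{C}(N,v^{\theta})$. That is, $\sum_{i\in N}MSE_i=v^{\theta}(N)$ and $\sum_{i\in M}MSE_i\ge v^{\theta}(M)$ for all $M\subseteq N$.
   Context: A transport choice situation is a tuple $\theta=(N,p,c,\alpha,\beta)$ with $N\subseteq\mathbb{N}$ a finite nonempty set (of transport operators), $p=(p_i)_{i\in N}$ (prices), $c=(c_i)_{i\in N}$ (cost prices) and $\alpha=(\alpha_i)_{i\in N}$ (alternative-specific constants) vectors with nonnegative real entries, and $\beta>0$ a real number (price sensitivity). $\Theta$ is the set of all transport choice situations. For $M\subseteq N$ and real vectors $x$ (indexed by $N$ or by $M$) let $D^M(x)=\sum_{i\in M}e^{\alpha_i-\beta x_i}$. The transport choice (TC) game $(N,v^{\theta})$ associated with $\theta$ is the function $v^\theta:2^N\to\mathbb{R}$ with $v^\theta(\emptyset)=0$ and, for nonempty $M\subseteq N$, $$v^{\theta}(M)=\max_{x\in\mathbb{R}^M}\ \sum_{i\in M}(x_i-c_i)\frac{e^{\alpha_i-\beta x_i}}{1+\sum_{j\in M}e^{\alpha_j-\beta x_j}+\sum_{j\in N\setminus M}e^{\alpha_j-\beta p_j}}$$ subject to $$\sum_{i\in M}\frac{e^{\alpha_i-\beta p_i}}{1+\sum_{j\in N}e^{\alpha_j-\beta p_j}}=\sum_{i\in M}\frac{e^{\alpha_i-\beta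 x_i}}{1+\sum_{j\in M}e^{\alpha_j-\beta x_j}+\sum_{j\in N\setminus M}e^{\alpha_j-\beta p_j}}.$$ The core is $$\mathscr{C}(N,v)=\Big\{x\in\mathbb{R}^N : \sum_{i\in M}x_i\ge v(M)\text{ for all }M\subseteq N,\ \sum_{i\in N}x_i=v(N)\Big\}.$$ Let $p^*\in\mathbb{R}^N$ be the price vector $p_i^*=c_i+\frac1\beta\ln\left(\frac{D^N(c)}{D^N(p)}\right)$, $i\in N$. The market share exchange (MSE) allocation rule is, for $i\in N$, $$MSE_i=(p_i^*-c_i)\frac{D^{\{i\}}(p^* )}{D^N(p^* )+1}-\phi\left(\frac{D^{\{i\}}(p^* )}{D^N(p^* )+1}-\frac{D^{\{i\}}(p)}{D^N(p)+1}\right),$$ where $$\phi=\frac{v^{\theta}(N)-v^{\widehat\theta}(N)}{D^N(p)/(D^N(p)+1)},\qquad \widehat\theta=(N,p,(p_i-1/\beta)_{i\in N},\alpha,\beta),$$ and $v^{\widehat\theta}(N)$ is given by the same definition as $v^\theta(N)$ with $c_i$ replaced by $p_i-1/\beta$ (these cost entries are allowed to be negative). *)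

theory Defs
  imports Complex_Main "HOL-Library.FuncSet"
begin

text \<open>Vectors indexed by a finite set \<open>M\<close> of operators, i.e. elements of \<open>\<real>\<close> to the power \<open>M\<close>,
  are the extensional functions \<open>M \<rightarrow>\<^sub>E UNIV\<close>.\<close>

record transport_choice =
  operators :: "nat set"
  price :: "nat \<Rightarrow> real"
  cost :: "nat \<Rightarrow> real"
  altconst :: "nat \<Rightarrow> real"
  sensitivity :: real

definition transport_choice_situations :: "transport_choice set" where
  "transport_choice_situations =
     {\<theta>. finite (operators \<theta>) \<and> operators \<theta> \<noteq> {} \<and>
          price \<theta> \<in> operators \<theta> \<rightarrow>\<^sub>E {0..} \<and>
          cost \<theta> \<in> operators \<theta> \<rightarrow>\<^sub>E {0..} \<and>
          altconst \<theta> \<in> operators \<theta> \<rightarrow>\<^sub>E {0..} \<and>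
          sensitivity \<theta> > 0}"

definition expsum :: "transport_choice \<Rightarrow> nat set \<Rightarrow> (nat \<Rightarrow> real) \<Rightarrow> real" where
  "expsum \<theta> M x = (\<Sum>i\<in>M. exp (altconst \<theta> i - sensitivity \<theta> * x i))"

text \<open>Market share of \<open>i \<in> M\<close> when the operators in \<open>M\<close> charge \<open>x\<close> and all others keep
  their original prices; the summand \<open>1\<close> is the outside option.\<close>

definition coalition_share ::
    "transport_choice \<Rightarrow> nat set \<Rightarrow> (nat \<Rightarrow> real) \<Rightarrow> nat \<Rightarrow> real" where
  "coalition_share \<theta> M x i =
     exp (altconst \<theta> i - sensitivity \<theta> * x i) /
     (1 + expsum \<theta> M x + expsum \<theta> (operators \<theta> - M) (price \<theta>))"

definition market_share :: "transport_choice \<Rightarrow> (nat \<Rightarrow> real) \<Rightarrow> nat \<Rightarrow> real" where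
  "market_share \<theta> x i = expsum \<theta> {i} x / (expsum \<theta> (operators \<theta>) x + 1)"

definition feasible_prices :: "transport_choice \<Rightarrow> nat set \<Rightarrow> (nat \<Rightarrow> real) set" where
  "feasible_prices \<theta> M =
     {x \<in> M \<rightarrow>\<^sub>E UNIV.
        (\<Sum>i\<in>M. market_share \<theta> (price \<theta>) i) = (\<Sum>i\<in>M. coalition_share \<theta> M x i)}"

definition coalition_profit ::
    "transport_choice \<Rightarrow> nat set \<Rightarrow> (nat \<Rightarrow> real) \<Rightarrow> real" where
  "coalition_profit \<theta> M x = (\<Sum>i\<in>M. (x i - cost \<theta> i) * coalition_share \<theta> M x i)"

text \<open>The value is an attained maximum, not merely a supremum. Costs are not required to be
  nonnegative here, so the definition also applies to \<open>shifted_situation\<close> below.\<close>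

definition tc_game :: "transport_choice \<Rightarrow> nat set \<Rightarrow> real" where
  "tc_game \<theta> M =
     (if M = {} then 0
      else (GREATEST w. w \<in> coalition_profit \<theta> M ` feasible_prices \<theta> M))"

definition core :: "nat set \<Rightarrow> (nat set \<Rightarrow> real) \<Rightarrow> (nat \<Rightarrow> real) set" where
  "core N v =
     {x \<in> N \<rightarrow>\<^sub>E UNIV. (\<forall>M\<subseteq>N. (\<Sum>i\<in>M. x i) \<ge> v M) \<and> (\<Sum>i\<in>N. x i) = v N}"

definition optimal_price :: "transport_choice \<Rightarrow> nat \<Rightarrow> real" where
  "optimal_price \<theta> =
     (\<lambda>i\<in>operators \<theta>. cost \<theta> i + 1 / sensitivity \<theta> *
        ln (expsum \<theta> (operators \<theta>) (cost \<theta>) / expsum \<theta> (operators \<theta>) (price \<theta>)))"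

definition shifted_situation :: "transport_choice \<Rightarrow> transport_choice" where
  "shifted_situation \<theta> =
     \<theta>\<lparr>cost := (\<lambda>i\<in>operators \<theta>. price \<theta> i - 1 / sensitivity \<theta>)\<rparr>"

definition exchange_price :: "transport_choice \<Rightarrow> real" where
  "exchange_price \<theta> =
     (tc_game \<theta> (operators \<theta>) - tc_game (shifted_situation \<theta>) (operators \<theta>)) /
     (expsum \<theta> (operators \<theta>) (price \<theta>) / (expsum \<theta> (operators \<theta>) (price \<theta>) + 1))"

definition MSE :: "transport_choice \<Rightarrow> nat \<Rightarrow> real" where
  "MSE \<theta> =
     (\<lambda>i\<in>operators \<theta>.
        (optimal_price \<theta> i - cost \<theta> i) * market_share \<theta> (optimal_price \<theta>) i -
        exchange_price \<theta> *
          (market_share \<theta> (optimal_price \<theta>) i - market_share \<theta> (price \<theta>) i))"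

end

theory Submission
  imports Defs
begin

text \<open>
  Write \<open>N\<close> for the set of operators, \<open>D\<^sup>M(x)\<close> for \<^term>\<open>expsum \<theta> M x\<close>, \<open>D\<^sub>i(x)\<close> for its summands,
  and \<open>p\<close>, \<open>c\<close>, \<open>\<beta>\<close> for the prices, the costs and the sensitivity of \<open>\<theta>\<close>. A coalition \<open>M\<close> has to preserve its total
  market share, and that share increases strictly with \<open>D\<^sup>M(x)\<close> while the other operators keep
  their prices. So the constraint says just \<open>D\<^sup>M(x) = D\<^sup>M(p)\<close>, and all denominators become
  \<open>1 + D\<^sup>N(p)\<close>. In terms of the weights \<open>a\<^sub>i = D\<^sub>i(x)\<close> and \<open>b\<^sub>i = D\<^sub>i(c)\<close> the margin \<open>x\<^sub>i - c\<^sub>i\<close> is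
  \<open>ln (b\<^sub>i / a\<^sub>i) / \<beta>\<close>, so the coalition maximises \<open>\<Sum> a\<^sub>i ln (b\<^sub>i / a\<^sub>i)\<close> under a fixed sum of the
  \<open>a\<^sub>i\<close>. By the log-sum inequality the maximum is at \<open>a\<close> proportional to \<open>b\<close>, that is, at equal
  margins, which gives the closed form (lemma \<open>tc_game_closed_form\<close>)
  \<open>v(M) = D\<^sup>M(p) ln (D\<^sup>M(c) / D\<^sup>M(p)) / (\<beta> (1 + D\<^sup>N(p)))\<close>.

  The costs \<open>p\<^sub>i - 1/\<beta>\<close> multiply every weight \<open>D\<^sub>i(p)\<close> by \<open>e\<close>, so the logarithm in the value of
  the shifted situation is \<open>1\<close>, and the exchange price is \<open>(L - 1) / \<beta>\<close> with
  \<open>L = ln (D\<^sup>N(c) / D\<^sup>N(p))\<close>. In the allocation the terms with \<open>L\<close> times the optimal market share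
  cancel, and what is left is additive over coalitions (lemma \<open>sum_MSE\<close>):
  \<open>\<Sum>i\<in>M. MSE\<^sub>i = (D\<^sup>M(c) D\<^sup>N(p) / D\<^sup>N(c) + (L - 1) D\<^sup>M(p)) / (\<beta> (1 + D\<^sup>N(p)))\<close>.
  With \<open>t = (D\<^sup>M(c) / D\<^sup>M(p)) / (D\<^sup>N(c) / D\<^sup>N(p))\<close>, this exceeds \<open>v(M)\<close> by \<open>t - 1 - ln t\<close> times a
  positive factor. That is nonnegative for every nonempty \<open>M\<close>, and for \<open>M = N\<close> it vanishes
  since \<open>t = 1\<close>. The allocation thus replaces the concave logarithm in \<open>v\<close> by its tangent at the ratio of the
  grand coalition.
\<close>

text \<open>The tangent of \<open>ln\<close> at \<open>B / A\<close> lies above its graph. This one inequality, scaled by \<open>a\<close>,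
  bounds the profits of coalitions and yields the core inequalities.\<close>

lemma scaled_ln_le_tangent:
  fixes a b A B :: real
  assumes "a > 0" "b > 0" "A > 0" "B > 0"
  shows "a * ln (b / a) \<le> b * (A / B) + (ln (B / A) - 1) * a"
proof -
  have "ln (b / a) - ln (B / A) = ln ((b / a) / (B / A))"
    using assms by (intro ln_divide_pos[symmetric]) simp_all
  also have "\<dots> \<le> (b / a) / (B / A) - 1"
    using assms by (intro ln_le_minus_one) simp
  finally have "a * ln (b / a) \<le> a * ((b / a) / (B / A) - 1 + ln (B / A))"
    using assms(1) by (intro mult_left_mono) auto
  also have "\<dots> = b * (A / B) + (ln (B / A) - 1) * a"
    using assms by (simp add: field_simps)
  finally show ?thesis .
qed

lemma log_sum_inequality:
  fixes a b :: "'i \<Rightarrow> real"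
  assumes "finite M" "M \<noteq> {}" "\<And>i. i \<in> M \<Longrightarrow> a i > 0" "\<And>i. i \<in> M \<Longrightarrow> b i > 0"
  shows "(\<Sum>i\<in>M. a i * ln (b i / a i)) \<le> sum a M * ln (sum b M / sum a M)"
proof -
  have pos: "sum a M > 0" "sum b M > 0"
    using assms by (auto intro: sum_pos)
  have "(\<Sum>i\<in>M. a i * ln (b i / a i))
      \<le> (\<Sum>i\<in>M. b i * (sum a M / sum b M) + (ln (sum b M / sum a M) - 1) * a i)"
    using assms pos by (intro sum_mono scaled_ln_le_tangent) auto
  also have "\<dots> = sum b M * (sum a M / sum b M) + (ln (sum b M / sum a M) - 1) * sum a M"
    by (simp only: sum.distrib sum_distrib_left sum_distrib_right)
  also have "\<dots> = sum a M * ln (sum b M / sum a M)"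
    using pos by (simp add: algebra_simps)
  finally show ?thesis .
qed

lemma expsum_pos: "finite M \<Longrightarrow> M \<noteq> {} \<Longrightarrow> expsum \<theta> M x > 0"
  unfolding expsum_def by (intro sum_pos) auto

lemma expsum_nonneg: "expsum \<theta> M x \<ge> 0"
  unfolding expsum_def by (intro sum_nonneg) auto

lemma expsum_cong: "(\<And>i. i \<in> M \<Longrightarrow> x i = y i) \<Longrightarrow> expsum \<theta> M x = expsum \<theta> M y"
  unfolding expsum_def by (intro sum.cong) auto

lemma expsum_singletons: "(\<Sum>i\<in>M. expsum \<theta> {i} x) = expsum \<theta> M x"
  by (simp add: expsum_def)

lemma expsum_split:
  assumes "finite N" "M \<subseteq> N"
  shows "expsum \<theta> N x = expsum \<theta> M x + expsum \<theta> (N - M) x"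
  unfolding expsum_def using sum.subset_diff[OF assms(2,1)] by (simp add: add.commute)

lemma expsum_add_const:
  "expsum \<theta> M (\<lambda>i. x i + d) = exp (- sensitivity \<theta> * d) * expsum \<theta> M x"
  by (simp add: expsum_def sum_distrib_left flip: exp_add) (simp add: algebra_simps)

text \<open>Equal margins over the costs rescale all weights by a common factor. With \<open>K = D\<^sup>M(c)\<close> and
  \<open>P = D\<^sup>M(p)\<close> the total over \<open>M\<close> becomes \<open>D\<^sup>M(p)\<close>, and these are the optimal prices of \<open>M\<close>.\<close>

lemma expsum_cost_plus_margin:
  assumes "sensitivity \<theta> > 0" "K > 0" "P > 0"
  shows "expsum \<theta> M (\<lambda>i. cost \<theta> i + 1 / sensitivity \<theta> * ln (K / P))
       = P / K * expsum \<theta> M (cost \<theta>)"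
proof -
  have "exp (- sensitivity \<theta> * (1 / sensitivity \<theta> * ln (K / P))) = exp (ln (P / K))"
    using assms by (simp add: ln_div)
  then show ?thesis
    using assms by (simp only: expsum_add_const exp_ln divide_pos_pos)
qed

text \<open>The share \<open>E / (1 + E + Q)\<close> of a coalition is injective in its own weight \<open>E\<close>, whatever the
  weight \<open>Q\<close> of the outsiders is.\<close>

lemma feasible_prices_iff:
  assumes "finite (operators \<theta>)" "M \<subseteq> operators \<theta>"
  shows "x \<in> feasible_prices \<theta> M \<longleftrightarrow>
         x \<in> M \<rightarrow>\<^sub>E UNIV \<and> expsum \<theta> M x = expsum \<theta> M (price \<theta>)"
proof -
  let ?Q = "expsum \<theta> (operators \<theta> - M) (price \<theta>)"
  let ?P = "expsum \<theta> M (price \<theta>)" and ?E = "expsum \<theta> M x"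
  have nonneg: "?Q \<ge> 0" "?P \<ge> 0" "?E \<ge> 0"
    by (simp_all add: expsum_nonneg)
  have "(\<Sum>i\<in>M. market_share \<theta> (price \<theta>) i) = ?P / (1 + ?P + ?Q)"
    using expsum_split[OF assms, of \<theta> "price \<theta>"]
    by (simp add: market_share_def expsum_singletons ac_simps flip: sum_divide_distrib)
  moreover have "(\<Sum>i\<in>M. coalition_share \<theta> M x i) = ?E / (1 + ?E + ?Q)"
    by (simp add: coalition_share_def expsum_def flip: sum_divide_distrib)
  moreover have "?P / (1 + ?P + ?Q) = ?E / (1 + ?E + ?Q) \<longleftrightarrow> ?P * (1 + ?Q) = ?E * (1 + ?Q)"
    using nonneg by (simp add: frac_eq_eq algebra_simps)
  ultimately show ?thesis
    using nonneg by (auto simp: feasible_prices_def)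
qed

lemma coalition_profit_feasible:
  assumes "finite (operators \<theta>)" "M \<subseteq> operators \<theta>" "sensitivity \<theta> > 0"
    and "x \<in> feasible_prices \<theta> M"
  shows "coalition_profit \<theta> M x =
    (\<Sum>i\<in>M. expsum \<theta> {i} x * ln (expsum \<theta> {i} (cost \<theta>) / expsum \<theta> {i} x)) /
    (sensitivity \<theta> * (1 + expsum \<theta> (operators \<theta>) (price \<theta>)))"
proof -
  have same: "expsum \<theta> M x = expsum \<theta> M (price \<theta>)"
    using assms by (simp add: feasible_prices_iff)
  have "(x i - cost \<theta> i) * coalition_share \<theta> M x i =
      expsum \<theta> {i} x * ln (expsum \<theta> {i} (cost \<theta>) / expsum \<theta> {i} x) /
      (sensitivity \<theta> * (1 + expsum \<theta> (operators \<theta>) (price \<theta>)))" for i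
  proof -
    have "ln (expsum \<theta> {i} (cost \<theta>) / expsum \<theta> {i} x) = sensitivity \<theta> * (x i - cost \<theta> i)"
      by (simp add: expsum_def ln_div algebra_simps)
    moreover have "coalition_share \<theta> M x i =
        expsum \<theta> {i} x / (1 + expsum \<theta> (operators \<theta>) (price \<theta>))"
      using same expsum_split[OF assms(1,2), of \<theta> "price \<theta>"]
      by (simp add: coalition_share_def expsum_def[of \<theta> "{i}"])
    ultimately show ?thesis
      using assms(3) by simp
  qed
  then show ?thesis
    by (simp add: coalition_profit_def sum_divide_distrib)
qed

lemma tc_game_closed_form:
  assumes "finite (operators \<theta>)" "M \<subseteq> operators \<theta>" "M \<noteq> {}" "sensitivity \<theta> > 0"
  shows "tc_game \<theta> M =
    expsum \<theta> M (price \<theta>) * ln (expsum \<theta> M (cost \<theta>) / expsum \<theta> M (price \<theta>)) /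
    (sensitivity \<theta> * (1 + expsum \<theta> (operators \<theta>) (price \<theta>)))" (is "_ = ?v")
proof -
  let ?P = "expsum \<theta> M (price \<theta>)" and ?K = "expsum \<theta> M (cost \<theta>)"
  let ?d = "sensitivity \<theta> * (1 + expsum \<theta> (operators \<theta>) (price \<theta>))"
  have fin: "finite M"
    using assms finite_subset by blast
  have pos: "?P > 0" "?K > 0" "?d > 0"
    using assms fin by (simp_all add: expsum_pos expsum_nonneg add_pos_nonneg)
  have upper: "coalition_profit \<theta> M x \<le> ?v" if x: "x \<in> feasible_prices \<theta> M" for x
  proof -
    have "(\<Sum>i\<in>M. expsum \<theta> {i} x * ln (expsum \<theta> {i} (cost \<theta>) / expsum \<theta> {i} x))
        \<le> ?P * ln (?K / ?P)"
      using log_sum_inequality[OF fin assms(3),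
          of "\<lambda>i. expsum \<theta> {i} x" "\<lambda>i. expsum \<theta> {i} (cost \<theta>)"] x assms
      by (simp add: expsum_pos expsum_singletons feasible_prices_iff)
    then show ?thesis
      using coalition_profit_feasible[OF assms(1,2,4) x] pos by (simp add: divide_right_mono)
  qed
  define y where "y = (\<lambda>i\<in>M. cost \<theta> i + 1 / sensitivity \<theta> * ln (?K / ?P))"
  \<comment> \<open>The case \<open>S = M\<close> shows that \<open>y\<close> is feasible, and singletons \<open>S\<close> show that all weights have
     the same ratio, which is the equality case of the log-sum inequality.\<close>
  have weight: "expsum \<theta> S y = ?P / ?K * expsum \<theta> S (cost \<theta>)" if "S \<subseteq> M" for S
  proof -
    have "expsum \<theta> S y = expsum \<theta> S (\<lambda>i. cost \<theta> i + 1 / sensitivity \<theta> * ln (?K / ?P))"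
      using that by (intro expsum_cong) (auto simp: y_def)
    then show ?thesis
      using expsum_cost_plus_margin[OF assms(4) pos(2,1)] by simp
  qed
  have y: "y \<in> feasible_prices \<theta> M"
    using assms pos weight[of M] by (simp add: feasible_prices_iff) (simp add: y_def)
  have "(\<Sum>i\<in>M. expsum \<theta> {i} y * ln (expsum \<theta> {i} (cost \<theta>) / expsum \<theta> {i} y))
      = (\<Sum>i\<in>M. expsum \<theta> {i} y * ln (?K / ?P))"
  proof (rule sum.cong)
    fix i assume "i \<in> M"
    have "expsum \<theta> {i} (cost \<theta>) > 0"
      by (simp add: expsum_pos)
    then show "expsum \<theta> {i} y * ln (expsum \<theta> {i} (cost \<theta>) / expsum \<theta> {i} y)
        = expsum \<theta> {i} y * ln (?K / ?P)"
      using weight[of "{i}"] \<open>i \<in> M\<close> pos by simp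
  qed simp
  also have "\<dots> = ?P * ln (?K / ?P)"
    using weight[of M] pos by (simp add: expsum_singletons flip: sum_distrib_right)
  finally have attained: "coalition_profit \<theta> M y = ?v"
    using coalition_profit_feasible[OF assms(1,2,4) y] by simp
  have "tc_game \<theta> M = (GREATEST w. w \<in> coalition_profit \<theta> M ` feasible_prices \<theta> M)"
    using assms(3) by (simp add: tc_game_def)
  also have "\<dots> = ?v"
  proof (rule Greatest_equality)
    show "?v \<in> coalition_profit \<theta> M ` feasible_prices \<theta> M"
      using y attained by (metis imageI)
  qed (use upper in auto)
  finally show ?thesis .
qed

lemma tc_game_shifted_situation:
  assumes "finite (operators \<theta>)" "operators \<theta> \<noteq> {}" "sensitivity \<theta> > 0"
  shows "tc_game (shifted_situation \<theta>) (operators \<theta>) =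
    expsum \<theta> (operators \<theta>) (price \<theta>) /
    (sensitivity \<theta> * (1 + expsum \<theta> (operators \<theta>) (price \<theta>)))"
proof -
  let ?\<theta>' = "shifted_situation \<theta>" and ?N = "operators \<theta>"
  have fields: "operators ?\<theta>' = ?N" "sensitivity ?\<theta>' = sensitivity \<theta>" "price ?\<theta>' = price \<theta>"
    by (simp_all add: shifted_situation_def)
  have expsum': "expsum ?\<theta>' M x = expsum \<theta> M x" for M x
    by (simp add: expsum_def shifted_situation_def)
  have "expsum \<theta> ?N (cost ?\<theta>') = expsum \<theta> ?N (\<lambda>i. price \<theta> i + - (1 / sensitivity \<theta>))"
    by (intro expsum_cong) (simp add: shifted_situation_def)
  also have "\<dots> = exp 1 * expsum \<theta> ?N (price \<theta>)"
    using assms(3) by (subst expsum_add_const) simp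
  finally have "expsum \<theta> ?N (cost ?\<theta>') / expsum \<theta> ?N (price \<theta>) = exp 1"
    using expsum_pos[OF assms(1,2), of \<theta> "price \<theta>"] by simp
  then show ?thesis
    using tc_game_closed_form[of ?\<theta>' ?N] assms by (simp add: fields expsum')
qed

lemma exchange_price_closed_form:
  assumes "finite (operators \<theta>)" "operators \<theta> \<noteq> {}" "sensitivity \<theta> > 0"
  shows "exchange_price \<theta> =
    (ln (expsum \<theta> (operators \<theta>) (cost \<theta>) / expsum \<theta> (operators \<theta>) (price \<theta>)) - 1) /
    sensitivity \<theta>"
proof -
  let ?A = "expsum \<theta> (operators \<theta>) (price \<theta>)" and ?K = "expsum \<theta> (operators \<theta>) (cost \<theta>)"
  have pos: "?A > 0"
    using assms by (simp add: expsum_pos)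
  have cancel: "(a * l / (b * (1 + a)) - a / (b * (1 + a))) / (a / (a + 1)) = (l - 1) / b"
    if "a > 0" "b > 0" for a b l :: real
  proof -
    have "a * l / (b * (1 + a)) - a / (b * (1 + a)) = (l - 1) / b * (a / (a + 1))"
      using that by (simp add: diff_divide_distrib algebra_simps)
    then show ?thesis
      using that by simp
  qed
  show ?thesis
    using cancel[OF pos assms(3), of "ln (?K / ?A)"]
    by (simp add: exchange_price_def tc_game_shifted_situation[OF assms]
        tc_game_closed_form[OF assms(1) order_refl assms(2,3)])
qed

lemma expsum_optimal_price:
  assumes "finite (operators \<theta>)" "operators \<theta> \<noteq> {}" "sensitivity \<theta> > 0" "M \<subseteq> operators \<theta>"
  shows "expsum \<theta> M (optimal_price \<theta>) =
    expsum \<theta> (operators \<theta>) (price \<theta>) / expsum \<theta> (operators \<theta>) (cost \<theta>) *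
    expsum \<theta> M (cost \<theta>)"
proof -
  let ?A = "expsum \<theta> (operators \<theta>) (price \<theta>)" and ?K = "expsum \<theta> (operators \<theta>) (cost \<theta>)"
  have "expsum \<theta> M (optimal_price \<theta>) =
      expsum \<theta> M (\<lambda>i. cost \<theta> i + 1 / sensitivity \<theta> * ln (?K / ?A))"
    using assms(4) by (intro expsum_cong) (auto simp: optimal_price_def)
  then show ?thesis
    using expsum_cost_plus_margin[of \<theta> ?K ?A M] assms by (simp add: expsum_pos)
qed

text \<open>Each operator earns the margin \<open>L / \<beta>\<close> on its optimal share but pays \<open>(L - 1) / \<beta>\<close> for the
  part by which this exceeds its original share. So \<open>1 / \<beta>\<close> times the optimal share remains, plus
  \<open>(L - 1) / \<beta>\<close> times the original share.\<close>

lemma sum_MSE: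
  fixes \<theta> :: transport_choice
  defines "A \<equiv> expsum \<theta> (operators \<theta>) (price \<theta>)"
    and "K \<equiv> expsum \<theta> (operators \<theta>) (cost \<theta>)"
  assumes "finite (operators \<theta>)" "operators \<theta> \<noteq> {}" "sensitivity \<theta> > 0" "M \<subseteq> operators \<theta>"
  shows "(\<Sum>i\<in>M. MSE \<theta> i) =
    (expsum \<theta> M (cost \<theta>) * (A / K) + (ln (K / A) - 1) * expsum \<theta> M (price \<theta>)) /
    (sensitivity \<theta> * (1 + A))"
proof -
  have pos: "A > 0" "K > 0"
    using assms by (simp_all add: expsum_pos)
  have total: "expsum \<theta> (operators \<theta>) (optimal_price \<theta>) = A"
    using expsum_optimal_price[OF assms(3-5) order_refl] pos by (simp add: A_def K_def)
  have regroup: "1 / b * l * (s / (a + 1)) - (l - 1) / b * (s / (a + 1) - r / (a + 1))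
      = (s + (l - 1) * r) / (b * (1 + a))" if "a > 0" "b > 0" for a b l r s :: real
    using that by (simp add: divide_simps) (simp add: algebra_simps)
  have MSE: "MSE \<theta> i =
      (expsum \<theta> {i} (cost \<theta>) * (A / K) + (ln (K / A) - 1) * expsum \<theta> {i} (price \<theta>)) /
      (sensitivity \<theta> * (1 + A))" if "i \<in> M" for i
  proof -
    have i: "i \<in> operators \<theta>"
      using that assms by auto
    have "optimal_price \<theta> i - cost \<theta> i = 1 / sensitivity \<theta> * ln (K / A)"
      using i by (simp add: optimal_price_def A_def K_def)
    moreover have "market_share \<theta> (optimal_price \<theta>) i =
        expsum \<theta> {i} (cost \<theta>) * (A / K) / (A + 1)"
      using i total expsum_optimal_price[OF assms(3-5), of "{i}"]
      by (simp add: market_share_def A_def K_def mult.commute)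
    moreover have "market_share \<theta> (price \<theta>) i = expsum \<theta> {i} (price \<theta>) / (A + 1)"
      by (simp add: market_share_def A_def)
    moreover have "exchange_price \<theta> = (ln (K / A) - 1) / sensitivity \<theta>"
      using exchange_price_closed_form[OF assms(3-5)] by (simp add: A_def K_def)
    ultimately show ?thesis
      using i regroup[OF pos(1) assms(5)] by (simp only: MSE_def restrict_apply' )
  qed
  have "(\<Sum>i\<in>M. MSE \<theta> i) =
      (\<Sum>i\<in>M. expsum \<theta> {i} (cost \<theta>) * (A / K) + (ln (K / A) - 1) * expsum \<theta> {i} (price \<theta>)) /
      (sensitivity \<theta> * (1 + A))"
    by (simp only: sum_divide_distrib MSE cong: sum.cong)
  also have "(\<Sum>i\<in>M. expsum \<theta> {i} (cost \<theta>) * (A / K)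
        + (ln (K / A) - 1) * expsum \<theta> {i} (price \<theta>)) =
      expsum \<theta> M (cost \<theta>) * (A / K) + (ln (K / A) - 1) * expsum \<theta> M (price \<theta>)"
    by (simp only: sum.distrib expsum_singletons flip: sum_distrib_left sum_distrib_right)
  finally show ?thesis .
qed

theorem theorem3:
  fixes \<theta> :: transport_choice
  assumes "\<theta> \<in> transport_choice_situations"
  shows "MSE \<theta> \<in> core (operators \<theta>) (tc_game \<theta>)"
proof -
  let ?N = "operators \<theta>"
  let ?A = "expsum \<theta> ?N (price \<theta>)" and ?K = "expsum \<theta> ?N (cost \<theta>)"
  have \<theta>: "finite ?N" "?N \<noteq> {}" "sensitivity \<theta> > 0"
    using assms by (auto simp: transport_choice_situations_def)
  have pos: "?A > 0" "?K > 0" "sensitivity \<theta> * (1 + ?A) > 0"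
    using \<theta> by (simp_all add: expsum_pos expsum_nonneg add_pos_nonneg)
  have "tc_game \<theta> M \<le> (\<Sum>i\<in>M. MSE \<theta> i)" if M: "M \<subseteq> ?N" for M
  proof (cases "M = {}")
    case True
    then show ?thesis
      by (simp add: tc_game_def)
  next
    case False
    let ?P = "expsum \<theta> M (price \<theta>)" and ?k = "expsum \<theta> M (cost \<theta>)"
    have "?P > 0" "?k > 0"
      using False finite_subset[OF M \<theta>(1)] by (simp_all add: expsum_pos)
    then have "?P * ln (?k / ?P) \<le> ?k * (?A / ?K) + (ln (?K / ?A) - 1) * ?P"
      using pos by (intro scaled_ln_le_tangent)
    then show ?thesis
      unfolding tc_game_closed_form[OF \<theta>(1) M False \<theta>(3)] sum_MSE[OF \<theta> M]
      using pos by (intro divide_right_mono) auto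
  qed
  moreover have "(\<Sum>i\<in>?N. MSE \<theta> i) = tc_game \<theta> ?N"
    unfolding tc_game_closed_form[OF \<theta>(1) order_refl \<theta>(2,3)] sum_MSE[OF \<theta> order_refl]
    using pos by (simp add: algebra_simps)
  moreover have "MSE \<theta> \<in> ?N \<rightarrow>\<^sub>E UNIV"
    by (simp add: MSE_def)
  ultimately show ?thesis
    by (simp add: core_def)
qed

end
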